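(* Let $A$ be a symmetric positive definite $n\times n$ matrix, and let $\{u^{\varepsilon}\}_{\varepsilon>0}$ be a family of smooth solutions on $\mathbb{R}\times[0,T]$ of $$\partial_t u+\partial_x F(u)=G(u)+\varepsilon(Au_{xx}-u_{tt}),\qquad u\in\mathbb{R}^n,$$ such that each $u^{\varepsilon}$ decays fast at infinity. Assume: (1) (Entropy) there are $\eta,q:\mathbb{R}^n\to\mathbb{R}$ and $\alpha,\beta>0$ with $\eta$ strictly convex, $\mathrm{D}\eta(u)\,\mathrm{D}F(u)=\mathrm{D}q(u)$, $\beta I\le \mathrm{D}^2\eta(u)\le\tfrac12\alpha I$ for all $u\in\mathbb{R}^n$, $\eta(u)\ge\eta(0)=0$ and $\mathrm{D}\eta(0)=0$; (2) (Subcharacteristic condition) for this $\alpha$ there is $\nu>0$ with $\tfrac12\big(A\,\mathrm{D}^2\eta(u)+\mathrm{D}^2\eta(u)A\big)-\alpha\,\mathrm{D}F(u)^{\top}\mathrm{D}F(u)\ge\nu I$ for all $u\in\mathbb{R}^n$; (3) (General source) for every compact set $\mathcal{A}\subset\mathbb{R}^n$ there is $L_{\mathcal{A}}>0$ such that $|G(u)-G(\bar u)|\le L_{\mathcal{A}}|u-\bar u|$ for all $u\in\mathbb{R}^n$, $\bar u\in\mathcal{A}$. Let $$\varphi(t)=\int_{\mathbb{R}}|u^{\varepsilon}|^2+\varepsilon^2|u^{\varepsilon}_x|^2+\varepsilon^2|u^{\varepsilon}_t|^2\,dx .$$ Then $$\varphi(t)\le C\,\varphi(0),\qquad t\in[0,T],$$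 with a constant $C=C(A,\alpha,\beta,T,L)>0$ independent of $\varepsilon$, where $L=L_{\{0\}}$ is the constant in (3) for $\mathcal{A}=\{0\}$.
   Context: $F,G:\mathbb{R}^n\to\mathbb{R}^n$ are column-vector valued, $F$ (and $\eta,q$) smooth, $G$ continuous with $G(0)=0$. $\mathrm{D}$ is the differential with respect to $u\in\mathbb{R}^n$, acting as a row operation; so $\mathrm{D}\eta$ is a row vector, $\mathrm{D}F$ the Jacobian, $\mathrm{D}^2\eta$ the Hessian. Matrix inequalities are in the sense of quadratic forms. "Decays fast at infinity" means: $u^{\varepsilon}$ and its derivatives tend to $0$ as $|x|\to\infty$, uniformly for $t\in[0,T]$, rapidly enough that all integrals over $\mathbb{R}$ that occur are finite and may be differentiated in $t$, and that boundary terms from integration in $x$ vanish. *)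

theory Defs
  imports "HOL-Analysis.Analysis"
begin

text \<open>Smoothness. Derivatives are taken within the set, so on a closed strip they are one-sided
  at the boundary; \<^const>\<open>frechet_derivative\<close> is uniquely determined on the sets used below
  (the whole space, and strips of positive width).\<close>

primrec C_k_on :: "nat \<Rightarrow> 'a::euclidean_space set \<Rightarrow> ('a \<Rightarrow> 'b::real_normed_vector) \<Rightarrow> bool" where
  "C_k_on 0 S f \<longleftrightarrow> continuous_on S f"
| "C_k_on (Suc k) S f \<longleftrightarrow> f differentiable_on S \<and>
     (\<forall>v. C_k_on k S (\<lambda>x. frechet_derivative f (at x within S) v))"

definition smooth_on :: "'a::euclidean_space set \<Rightarrow> ('a \<Rightarrow> 'b::real_normed_vector) \<Rightarrow> bool" where
  "smooth_on S f \<longleftrightarrow> (\<forall>k. C_k_on k S f)"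

definition strictly_convex :: "('a::real_vector \<Rightarrow> real) \<Rightarrow> bool" where
  "strictly_convex f \<longleftrightarrow> (\<forall>x y s. x \<noteq> y \<longrightarrow> 0 < s \<longrightarrow> s < 1 \<longrightarrow>
     f ((1 - s) *\<^sub>R x + s *\<^sub>R y) < (1 - s) * f x + s * f y)"

text \<open>Matrices. \<open>row_D f u\<close> is the row vector \<open>D f(u)\<close>; the differential of a vector-valued map
  is \<^const>\<open>jacobian\<close>.\<close>

definition row_D :: "(real^'n \<Rightarrow> real) \<Rightarrow> real^'n \<Rightarrow> real^'n" where
  "row_D f u = (\<chi> j. frechet_derivative f (at u) (axis j 1))"

definition hessian :: "(real^'n \<Rightarrow> real) \<Rightarrow> real^'n \<Rightarrow> real^'n^'n" where
  "hessian f u = jacobian (row_D f) (at u)"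

definition qf_le :: "real^'n^'n \<Rightarrow> real^'n^'n \<Rightarrow> bool" where
  "qf_le M N \<longleftrightarrow> (\<forall>v. v \<bullet> (M *v v) \<le> v \<bullet> (N *v v))"

definition sym_pos_def :: "real^'n^'n \<Rightarrow> bool" where
  "sym_pos_def A \<longleftrightarrow> transpose A = A \<and> (\<forall>v. v \<noteq> 0 \<longrightarrow> 0 < v \<bullet> (A *v v))"

text \<open>Functions of \<open>(x, t)\<close> on the strip \<open>\<real> \<times> [0, T]\<close>; at \<open>t = 0\<close> and \<open>t = T\<close> the
  time derivative is one-sided.\<close>

definition strip :: "real \<Rightarrow> (real \<times> real) set" where
  "strip T = UNIV \<times> {0..T}"

definition dx :: "(real \<times> real \<Rightarrow> 'a::real_normed_vector) \<Rightarrow> real \<times> real \<Rightarrow> 'a" where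
  "dx u = (\<lambda>(x, t). vector_derivative (\<lambda>y. u (y, t)) (at x))"

definition dt :: "real \<Rightarrow> (real \<times> real \<Rightarrow> 'a::real_normed_vector) \<Rightarrow> real \<times> real \<Rightarrow> 'a" where
  "dt T u = (\<lambda>(x, t). vector_derivative (\<lambda>s. u (x, s)) (at t within {0..T}))"

definition solves :: "real^'n^'n \<Rightarrow> (real^'n \<Rightarrow> real^'n) \<Rightarrow> (real^'n \<Rightarrow> real^'n) \<Rightarrow> real \<Rightarrow> real
    \<Rightarrow> (real \<times> real \<Rightarrow> real^'n) \<Rightarrow> bool" where
  "solves A F G T \<epsilon> u \<longleftrightarrow> (\<forall>p\<in>strip T.
     dt T u p + dx (\<lambda>p. F (u p)) p
       = G (u p) + \<epsilon> *\<^sub>R (A *v dx (dx u) p - dt T (dt T u) p))"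

text \<open>Fast decay: all derivatives tend to 0 as \<open>\<bar>x\<bar> \<rightarrow> \<infinity>\<close>, uniformly in \<open>t\<close>, and those of order at
  most 2 have a square-integrable majorant independent of \<open>t\<close>. Hence products of any two of the
  latter are dominated by an integrable function independent of \<open>t\<close>, which is what makes the
  integrals of the energy estimate finite and differentiable under the integral sign.\<close>

definition decays_fast :: "real \<Rightarrow> (real \<times> real \<Rightarrow> 'a::real_normed_vector) \<Rightarrow> bool" where
  "decays_fast T u \<longleftrightarrow>
     (\<forall>j k. uniform_limit {0..T} (\<lambda>x t. (dx ^^ j) ((dt T ^^ k) u) (x, t)) (\<lambda>t. 0) at_infinity) \<and>
     (\<forall>j k. j + k \<le> 2 \<longrightarrow> (\<exists>g::real \<Rightarrow> real. integrable lborel (\<lambda>x. (g x)\<^sup>2) \<and>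
        (\<forall>x. \<forall>t\<in>{0..T}. norm ((dx ^^ j) ((dt T ^^ k) u) (x, t)) \<le> g x)))"

definition entropy_condition :: "(real^'n \<Rightarrow> real^'n) \<Rightarrow> (real^'n \<Rightarrow> real) \<Rightarrow> (real^'n \<Rightarrow> real)
    \<Rightarrow> real \<Rightarrow> real \<Rightarrow> bool" where
  "entropy_condition F \<eta> q \<alpha> \<beta> \<longleftrightarrow>
     smooth_on UNIV \<eta> \<and> smooth_on UNIV q \<and> 0 < \<alpha> \<and> 0 < \<beta> \<and> strictly_convex \<eta> \<and>
     (\<forall>u. row_D \<eta> u v* jacobian F (at u) = row_D q u) \<and>
     (\<forall>u. qf_le (mat \<beta>) (hessian \<eta> u) \<and> qf_le (hessian \<eta> u) (mat (\<alpha> / 2))) \<and>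
     (\<forall>u. \<eta> u \<ge> \<eta> 0) \<and> \<eta> 0 = 0 \<and> row_D \<eta> 0 = 0"

definition subcharacteristic :: "real^'n^'n \<Rightarrow> (real^'n \<Rightarrow> real^'n) \<Rightarrow> (real^'n \<Rightarrow> real) \<Rightarrow> real \<Rightarrow> bool"
  where
  "subcharacteristic A F \<eta> \<alpha> \<longleftrightarrow> (\<exists>\<nu>>0. \<forall>u. qf_le (mat \<nu>)
     ((1 / 2) *\<^sub>R (A ** hessian \<eta> u + hessian \<eta> u ** A)
       - \<alpha> *\<^sub>R (transpose (jacobian F (at u)) ** jacobian F (at u))))"

text \<open>\<open>\<L> K\<close> is the constant belonging to the compact set \<open>K\<close>.\<close>

definition general_source :: "(real^'n \<Rightarrow> real^'n) \<Rightarrow> ((real^'n) set \<Rightarrow> real) \<Rightarrow> bool" where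
  "general_source G \<L> \<longleftrightarrow> (\<forall>K. compact K \<longrightarrow> 0 < \<L> K \<and>
     (\<forall>u. \<forall>w\<in>K. norm (G u - G w) \<le> \<L> K * norm (u - w)))"

definition energy :: "real \<Rightarrow> real \<Rightarrow> (real \<times> real \<Rightarrow> real^'n) \<Rightarrow> real \<Rightarrow> real" where
  "energy T \<epsilon> u t = (LINT x|lborel. (norm (u (x, t)))\<^sup>2
     + \<epsilon>\<^sup>2 * (norm (dx u (x, t)))\<^sup>2 + \<epsilon>\<^sup>2 * (norm (dt T u (x, t)))\<^sup>2)"

end

theory Submission
  imports Defs
begin

text \<open>Testing the equation with \<open>D\<eta>(u)\<close> and with \<open>\<epsilon> \<alpha> u\<^sub>t\<close> and adding gives the pointwise
  balance law \<open>\<partial>\<^sub>t e - \<partial>\<^sub>x j = r\<close> for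
  \<open>e = \<eta>(u) + \<epsilon> D\<eta>(u) u\<^sub>t + \<epsilon>\<^sup>2 \<alpha>/2 (\<bar>u\<^sub>t\<bar>\<^sup>2 + u\<^sub>x \<bullet> A u\<^sub>x)\<close>.
  By the subcharacteristic condition the terms of \<open>r\<close> without \<open>G\<close> are nonpositive, and those with
  \<open>G\<close> are at most \<open>\<alpha> L (\<bar>u\<bar>\<^sup>2 + \<epsilon>\<^sup>2 \<bar>u\<^sub>t\<bar>\<^sup>2)\<close>. Since \<open>\<bar>D\<eta>\<bar>\<^sup>2 \<le> \<alpha> \<eta>\<close>, the density \<open>e\<close> is
  comparable with the energy density, uniformly in \<open>\<epsilon>\<close>. Gronwall's lemma is applied to the integral
  of \<open>e\<close> over a bounded interval, where the boundary fluxes are uniformly small, so that no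
  differentiation under an improper integral is needed.\<close>

section \<open>Smooth functions on the strip\<close>

lemma C_k_on_cong:
  assumes "\<And>x. x \<in> S \<Longrightarrow> f x = g x" "C_k_on k S f"
  shows "C_k_on k S g"
  using assms
proof (induction k arbitrary: f g)
  case 0
  then show ?case by (auto cong: continuous_on_cong)
next
  case (Suc k)
  \<comment> \<open>Equivalence for every candidate \<open>D\<close> makes the choice in
    \<open>frechet_derivative\<close> literally the same for \<open>f\<close> and \<open>g\<close>,
    so no uniqueness of the derivative on \<open>S\<close> is required.\<close>
  have iff: "(f has_derivative D) (at x within S) \<longleftrightarrow> (g has_derivative D) (at x within S)"
    if x: "x \<in> S" for x D
  proof
    assume "(f has_derivative D) (at x within S)"
    then show "(g has_derivative D) (at x within S)"
      by (rule has_derivative_transform[OF x, rotated]) (simp add: Suc.prems(1))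
  next
    assume "(g has_derivative D) (at x within S)"
    then show "(f has_derivative D) (at x within S)"
      by (rule has_derivative_transform[OF x, rotated]) (simp add: Suc.prems(1))
  qed
  have "C_k_on k S (\<lambda>x. frechet_derivative g (at x within S) v)" for v
  proof (rule Suc.IH)
    show "C_k_on k S (\<lambda>x. frechet_derivative f (at x within S) v)"
      using Suc.prems(2) by simp
  qed (simp add: frechet_derivative_def iff)
  moreover have "g differentiable_on S"
    using Suc.prems(2) by (simp add: differentiable_on_def differentiable_def iff)
  ultimately show ?case by simp
qed

lemma smooth_on_cong:
  "(\<And>x. x \<in> S \<Longrightarrow> f x = g x) \<Longrightarrow> smooth_on S f \<Longrightarrow> smooth_on S g"
  unfolding smooth_on_def using C_k_on_cong by blast

lemma smooth_on_imp_continuous_on: "smooth_on S f \<Longrightarrow> continuous_on S f"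
  unfolding smooth_on_def by (metis C_k_on.simps(1))

lemma smooth_on_imp_differentiable_on: "smooth_on S f \<Longrightarrow> f differentiable_on S"
  unfolding smooth_on_def by (metis C_k_on.simps(2))

lemma smooth_on_frechet_derivative:
  "smooth_on S f \<Longrightarrow> smooth_on S (\<lambda>x. frechet_derivative f (at x within S) v)"
  unfolding smooth_on_def by (metis C_k_on.simps(2))

lemma smooth_on_has_derivative:
  "smooth_on S f \<Longrightarrow> x \<in> S \<Longrightarrow>
    (f has_derivative frechet_derivative f (at x within S)) (at x within S)"
  using smooth_on_imp_differentiable_on[of S f]
  by (auto simp: differentiable_on_def frechet_derivative_works[symmetric])

lemma mem_strip [simp]: "(x, t) \<in> strip T \<longleftrightarrow> 0 \<le> t \<and> t \<le> T"
  by (auto simp: strip_def)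

lemma smooth_on_strip_has_dx:
  assumes "smooth_on (strip T) u" "t \<in> {0..T}"
  shows "((\<lambda>y. u (y, t)) has_vector_derivative dx u (x, t)) (at x)"
    and "dx u (x, t) = frechet_derivative u (at (x, t) within strip T) (1, 0)"
proof -
  let ?D = "\<lambda>p. frechet_derivative u (at p within strip T)"
  have D: "(u has_derivative ?D p) (at p within strip T)" if "p \<in> strip T" for p
    using assms that by (intro smooth_on_has_derivative) auto
  then interpret bounded_linear "?D (x, t)"
    using assms(2) by (intro has_derivative_bounded_linear[OF D]) auto
  have "((\<lambda>y. u (y, t)) has_derivative (\<lambda>h. ?D (x, t) (h, 0))) (at x)"
    using assms(2) by (intro has_derivative_in_compose2[OF D]) (auto intro!: derivative_eq_intros)
  also have "(\<lambda>h. ?D (x, t) (h, 0)) = (\<lambda>h. h *\<^sub>R ?D (x, t) (1, 0))"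
    by (simp flip: scaleR)
  finally have *: "((\<lambda>y. u (y, t)) has_vector_derivative ?D (x, t) (1, 0)) (at x)"
    by (simp add: has_vector_derivative_def)
  then show eq: "dx u (x, t) = ?D (x, t) (1, 0)"
    by (simp add: dx_def vector_derivative_at)
  show "((\<lambda>y. u (y, t)) has_vector_derivative dx u (x, t)) (at x)"
    using * eq by simp
qed

lemma smooth_on_strip_has_dt:
  assumes "smooth_on (strip T) u" "t \<in> {0..T}" "0 < T"
  shows "((\<lambda>s. u (x, s)) has_vector_derivative dt T u (x, t)) (at t within {0..T})"
    and "dt T u (x, t) = frechet_derivative u (at (x, t) within strip T) (0, 1)"
proof -
  let ?D = "\<lambda>p. frechet_derivative u (at p within strip T)"
  have D: "(u has_derivative ?D p) (at p within strip T)" if "p \<in> strip T" for p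
    using assms that by (intro smooth_on_has_derivative) auto
  then interpret bounded_linear "?D (x, t)"
    using assms(2) by (intro has_derivative_bounded_linear[OF D]) auto
  have "((\<lambda>s. u (x, s)) has_derivative (\<lambda>h. ?D (x, t) (0, h))) (at t within {0..T})"
    using assms(2) by (intro has_derivative_in_compose2[OF D]) (auto intro!: derivative_eq_intros)
  also have "(\<lambda>h. ?D (x, t) (0, h)) = (\<lambda>h. h *\<^sub>R ?D (x, t) (0, 1))"
    by (simp flip: scaleR)
  finally have *: "((\<lambda>s. u (x, s)) has_vector_derivative ?D (x, t) (0, 1)) (at t within {0..T})"
    by (simp add: has_vector_derivative_def)
  \<comment> \<open>Since \<open>0 < T\<close>, the interval \<open>{0..T}\<close> is nondegenerate,
    so the one-sided derivative at its end points is unique and is the one that \<open>dt\<close>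
    selects.\<close>
  then show eq: "dt T u (x, t) = ?D (x, t) (0, 1)"
    using vector_derivative_within_cbox[of 0 T t "\<lambda>s. u (x, s)"] assms(2,3)
    by (simp add: dt_def)
  show "((\<lambda>s. u (x, s)) has_vector_derivative dt T u (x, t)) (at t within {0..T})"
    using * eq by simp
qed

text \<open>Off the strip \<open>dx u\<close> is uncontrolled, but on it \<open>dx u\<close> is the
  Frechet derivative in direction \<open>(1, 0)\<close>, and smoothness on a set depends only on the
  values there.\<close>

lemma smooth_on_strip_dx: "smooth_on (strip T) u \<Longrightarrow> smooth_on (strip T) (dx u)"
  by (rule smooth_on_cong[OF _ smooth_on_frechet_derivative[of _ u "(1, 0)"]])
    (auto simp: smooth_on_strip_has_dx(2))

lemma smooth_on_strip_dt: "0 < T \<Longrightarrow> smooth_on (strip T) u \<Longrightarrow> smooth_on (strip T) (dt T u)"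
  by (rule smooth_on_cong[OF _ smooth_on_frechet_derivative[of _ u "(0, 1)"]])
    (auto simp: smooth_on_strip_has_dt(2))

text \<open>Writing \<open>f\<close> as the time integral of \<open>ft\<close> gives the mixed derivative at the end points of
  the time interval as well, where the symmetry of second derivatives does not apply.\<close>

lemma has_vector_derivative_mixed:
  fixes f fx ft ftx :: "real \<Rightarrow> real \<Rightarrow> 'a::banach"
  assumes fx: "\<And>x t. t \<in> {0..T} \<Longrightarrow> ((\<lambda>y. f y t) has_vector_derivative fx x t) (at x)"
    and ft: "\<And>x t. t \<in> {0..T} \<Longrightarrow> (f x has_vector_derivative ft x t) (at t within {0..T})"
    and ftx: "\<And>x t. t \<in> {0..T} \<Longrightarrow> ((\<lambda>y. ft y t) has_vector_derivative ftx x t) (at x)"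
    and cont: "\<And>x. continuous_on {0..T} (ft x)"
      "continuous_on (UNIV \<times> {0..T}) (\<lambda>(x, t). ftx x t)"
    and t: "t \<in> {0..T}"
  shows "(fx x has_vector_derivative ftx x t) (at t within {0..T})"
proof -
  have eq: "fx x s = fx x 0 + integral {0..s} (ftx x)" if s: "s \<in> {0..T}" for s
  proof -
    have f_eq: "f y s = f y 0 + integral {0..s} (ft y)" for y
    proof -
      have "(ft y has_integral f y s - f y 0) {0..s}"
        using s by (intro fundamental_theorem_of_calculus)
          (auto intro: has_vector_derivative_within_subset[OF ft])
      then show ?thesis by (simp add: integral_unique)
    qed
    have "((\<lambda>y. integral (cbox 0 s) (ft y)) has_vector_derivative integral (cbox 0 s) (ftx x))
        (at x within UNIV)"
      using s
      by (intro leibniz_rule_vector_derivative)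
        (auto intro!: ftx integrable_continuous_real continuous_on_subset[OF cont(1)]
          continuous_on_subset[OF cont(2)])
    then have "((\<lambda>y. f y 0 + integral {0..s} (ft y)) has_vector_derivative
        fx x 0 + integral {0..s} (ftx x)) (at x)"
      using s by (intro has_vector_derivative_add fx) auto
    then have "((\<lambda>y. f y s) has_vector_derivative fx x 0 + integral {0..s} (ftx x)) (at x)"
      by (simp flip: f_eq)
    with fx[OF s] show ?thesis by (metis vector_derivative_at)
  qed
  have "continuous_on {0..T} (ftx x)"
    using continuous_on_compose2[OF cont(2), of "{0..T}" "\<lambda>s. (x, s)"]
    by (simp add: image_subset_iff continuous_on_Pair continuous_on_const continuous_on_id)
  then have "((\<lambda>s. fx x 0 + integral {0..s} (ftx x)) has_vector_derivative 0 + ftx x t)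
      (at t within {0..T})"
    using t by (intro has_vector_derivative_add integral_has_vector_derivative) auto
  then have "((\<lambda>s. fx x 0 + integral {0..s} (ftx x)) has_vector_derivative ftx x t)
      (at t within {0..T})"
    by simp
  with t eq show ?thesis by (rule has_vector_derivative_transform)
qed

text \<open>Supplies the time derivative of \<open>u_x\<close> in the quadratic term
  \<open>u_x \<bullet> A u_x\<close> of the entropy density, in the form \<open>dx (dt T u)\<close>
  in which it also appears in the flux derivative, so that the two cancel.\<close>

lemma smooth_on_strip_has_dt_dx:
  fixes u :: "real \<times> real \<Rightarrow> 'a::euclidean_space"
  assumes u: "smooth_on (strip T) u" and t: "t \<in> {0..T}" and T: "0 < T"
  shows "((\<lambda>s. dx u (x, s)) has_vector_derivative dx (dt T u) (x, t)) (at t within {0..T})"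
proof (rule has_vector_derivative_mixed[where f="\<lambda>x t. u (x, t)" and ft="\<lambda>x t. dt T u (x, t)"])
  note sm = smooth_on_strip_dt[OF T u]
  show "((\<lambda>y. u (y, t)) has_vector_derivative dx u (x, t)) (at x)" if "t \<in> {0..T}" for x t
    using smooth_on_strip_has_dx(1)[OF u that] .
  show "((\<lambda>s. u (x, s)) has_vector_derivative dt T u (x, t)) (at t within {0..T})"
    if "t \<in> {0..T}" for x t
    using smooth_on_strip_has_dt(1)[OF u that T] .
  show "((\<lambda>y. dt T u (y, t)) has_vector_derivative dx (dt T u) (x, t)) (at x)"
    if "t \<in> {0..T}" for x t
    using smooth_on_strip_has_dx(1)[OF sm that] .
  show "continuous_on {0..T} (\<lambda>t. dt T u (x, t))" for x
    by (rule continuous_on_compose2[OF smooth_on_imp_continuous_on[OF sm]])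
      (auto intro!: continuous_intros)
  show "continuous_on (UNIV \<times> {0..T}) (\<lambda>(x, t). dx (dt T u) (x, t))"
    using smooth_on_imp_continuous_on[OF smooth_on_strip_dx[OF sm]] by (simp add: strip_def)
qed (fact t)

section \<open>Gradient and Hessian\<close>

lemma smooth_on_has_row_D:
  assumes "smooth_on UNIV f"
  shows "(f has_derivative (\<lambda>h. row_D f u \<bullet> h)) (at u)"
proof -
  let ?D = "frechet_derivative f (at u)"
  have D: "(f has_derivative ?D) (at u)"
    using smooth_on_has_derivative[OF assms] by simp
  then have lin: "linear ?D" by (rule has_derivative_linear)
  have "?D h = row_D f u \<bullet> h" for h
  proof -
    have "?D h = ?D (\<Sum>i\<in>UNIV. h $ i *\<^sub>R axis i 1)"
      using basis_expansion[of h] by (simp add: scalar_mult_eq_scaleR)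
    also have "\<dots> = row_D f u \<bullet> h"
      by (simp add: linear_sum[OF lin] linear_scale[OF lin] row_D_def inner_vec_def mult.commute)
    finally show ?thesis .
  qed
  then have "?D = (\<lambda>h. row_D f u \<bullet> h)" by auto
  with D show ?thesis by simp
qed

lemma smooth_on_row_D_component:
  "smooth_on UNIV f \<Longrightarrow> smooth_on UNIV (\<lambda>u. row_D f u $ j)"
  using smooth_on_frechet_derivative[of UNIV f "axis j 1"] by (simp add: row_D_def)

text \<open>Each component of the gradient is a directional derivative of \<open>f\<close>, hence
  smooth; differentiability of \<open>row_D f\<close> follows componentwise.\<close>

lemma smooth_on_has_hessian:
  assumes "smooth_on UNIV f"
  shows "(row_D f has_derivative (\<lambda>h. hessian f u *v h)) (at u)"
proof -
  have "row_D f differentiable (at u)"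
    using smooth_on_imp_differentiable_on[OF smooth_on_row_D_component[OF assms]]
    by (subst differentiable_componentwise_within)
      (auto simp: Basis_vec_def differentiable_on_def cart_eq_inner_axis[symmetric])
  then show ?thesis
    unfolding hessian_def by (simp flip: jacobian_works)
qed

text \<open>Writes the entries as iterated directional derivatives, the form in which
  \<open>smooth_on\<close> yields their continuity.\<close>

lemma hessian_component:
  assumes "smooth_on UNIV f"
  shows "hessian f u $ i $ j = frechet_derivative (\<lambda>u. row_D f u $ i) (at u) (axis j 1)"
proof -
  have "((\<lambda>u. row_D f u $ i) has_derivative (\<lambda>h. (hessian f u *v h) $ i)) (at u)"
    using bounded_linear.has_derivative[OF bounded_linear_vec_nth smooth_on_has_hessian[OF assms]] .
  then have "frechet_derivative (\<lambda>u. row_D f u $ i) (at u) = (\<lambda>h. (hessian f u *v h) $ i)"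
    by (rule frechet_derivative_at[symmetric])
  then show ?thesis
    by (simp add: matrix_vector_mult_basis column_def)
qed

lemma continuous_on_hessian:
  assumes "smooth_on UNIV f"
  shows "continuous_on UNIV (hessian f)"
proof -
  have "continuous_on UNIV (\<lambda>u. hessian f u $ i $ j)" for i j
    using smooth_on_imp_continuous_on[OF
        smooth_on_frechet_derivative[OF smooth_on_row_D_component[OF assms], where v="axis j 1"]]
    by (simp add: hessian_component[OF assms])
  then show ?thesis
    by (intro continuous_on_vec_lambda[of UNIV "\<lambda>i u. hessian f u $ i", simplified]
        continuous_on_vec_lambda[of UNIV "\<lambda>j u. hessian f u $ i $ j" for i, simplified])
qed

lemma continuous_on_row_D:
  "smooth_on UNIV f \<Longrightarrow> continuous_on UNIV (row_D f)"
  by (rule has_derivative_continuous_on, rule has_derivative_at_withinI,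
      erule smooth_on_has_hessian)

lemma continuous_on_matrix_vector_mult [continuous_intros]:
  fixes M :: "'a::topological_space \<Rightarrow> real^'n^'m"
  assumes "continuous_on S M" "continuous_on S v"
  shows "continuous_on S (\<lambda>x. M x *v v x)"
  unfolding matrix_vector_mult_def
  by (intro continuous_on_vec_lambda continuous_intros continuous_on_component assms)

lemma hessian_line:
  assumes "smooth_on UNIV f"
  shows "((\<lambda>s. f (u + s *\<^sub>R h)) has_vector_derivative row_D f (u + s *\<^sub>R h) \<bullet> h) (at s within S)"
    and "((\<lambda>s. row_D f (u + s *\<^sub>R h) \<bullet> k) has_vector_derivative
      k \<bullet> (hessian f (u + s *\<^sub>R h) *v h)) (at s within S)"
proof -
  have l: "((\<lambda>s. u + s *\<^sub>R h) has_derivative (\<lambda>d. d *\<^sub>R h)) (at s within S)"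
    by (auto intro!: derivative_eq_intros)
  show "((\<lambda>s. f (u + s *\<^sub>R h)) has_vector_derivative row_D f (u + s *\<^sub>R h) \<bullet> h) (at s within S)"
    using has_derivative_compose[OF l smooth_on_has_row_D[OF assms]]
    by (simp add: has_vector_derivative_def)
  show "((\<lambda>s. row_D f (u + s *\<^sub>R h) \<bullet> k) has_vector_derivative
      k \<bullet> (hessian f (u + s *\<^sub>R h) *v h)) (at s within S)"
    using has_derivative_inner_left[OF has_derivative_compose[OF l smooth_on_has_hessian[OF assms]], of k]
    by (simp add: has_vector_derivative_def matrix_vector_mult_scaleR inner_commute)
qed

text \<open>Schwarz's theorem from \<open>has_vector_derivative_mixed\<close> on the surface
  \<open>u + x v + t w\<close>: the derivative of \<open>row_D f \<bullet> v\<close> in direction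
  \<open>w\<close> is computed once through that lemma and once by the chain rule, and a one-sided
  derivative at \<open>0\<close> within \<open>{0..1}\<close> is unique.\<close>

lemma hessian_symmetric:
  assumes f: "smooth_on UNIV f"
  shows "v \<bullet> (hessian f u *v w) = w \<bullet> (hessian f u *v v)"
proof -
  let ?p = "\<lambda>x t. u + x *\<^sub>R v + t *\<^sub>R w"
  have p: "?p x t = (u + t *\<^sub>R w) + x *\<^sub>R v" for x t by simp
  have "((\<lambda>t. row_D f (?p 0 t) \<bullet> v) has_vector_derivative w \<bullet> (hessian f (?p 0 0) *v v))
      (at 0 within {0..1})"
  proof (rule has_vector_derivative_mixed[where f="\<lambda>x t. f (?p x t)" 
        and ft="\<lambda>x t. row_D f (?p x t) \<bullet> w" and fx="\<lambda>x t. row_D f (?p x t) \<bullet> v"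
        and ftx="\<lambda>x t. w \<bullet> (hessian f (?p x t) *v v)" and x=0 and t=0])
    show "((\<lambda>y. f (?p y t)) has_vector_derivative row_D f (?p x t) \<bullet> v) (at x)" for x t
      unfolding p by (rule hessian_line[OF f])
    show "((\<lambda>y. row_D f (?p y t) \<bullet> w) has_vector_derivative w \<bullet> (hessian f (?p x t) *v v)) (at x)"
      for x t
      unfolding p by (rule hessian_line[OF f])
    show "((\<lambda>t. f (?p x t)) has_vector_derivative row_D f (?p x t) \<bullet> w) (at t within {0..1})" for x t
      by (rule hessian_line[OF f])
    show "continuous_on {0..1} (\<lambda>t. row_D f (?p x t) \<bullet> w)" for x
      by (intro continuous_intros continuous_on_compose2[OF continuous_on_row_D[OF f]]) auto
    show "continuous_on (UNIV \<times> {0..1}) (\<lambda>(x, t). w \<bullet> (hessian f (?p x t) *v v))"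
      unfolding split_beta
      by (intro continuous_intros continuous_on_compose2[OF continuous_on_hessian[OF f]]) auto
  qed simp
  moreover have "((\<lambda>t. row_D f (?p 0 t) \<bullet> v) has_vector_derivative v \<bullet> (hessian f (?p 0 0) *v w))
      (at 0 within {0..1})"
    using hessian_line(2)[OF f, of "u + 0 *\<^sub>R v" w v 0] by simp
  ultimately show ?thesis
    using vector_derivative_unique_within[of 0 "{0..1}"] by (fastforce simp: trivial_limit_within)
qed

text \<open>Lagrange's form of the remainder for \<open>s \<mapsto> f (u + s h)\<close> on
  \<open>[0, 1]\<close>. The location of \<open>s\<close> is not recorded because the Hessian bounds
  to be inserted hold on the whole space.\<close>

lemma smooth_on_taylor:
  assumes f: "smooth_on UNIV f"
  obtains s where "f (u + h) = f u + row_D f u \<bullet> h + (h \<bullet> (hessian f (u + s *\<^sub>R h) *v h)) / 2"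
proof -
  \<comment> \<open>\<open>Maclaurin2\<close> expects a sequence of derivatives but constrains it
    only below order 2; from index 2 on the second derivative is repeated as a filler.\<close>
  define diff where "diff = (\<lambda>(m::nat) s.
    if m = 0 then f (u + s *\<^sub>R h) else if m = 1 then row_D f (u + s *\<^sub>R h) \<bullet> h
     else h \<bullet> (hessian f (u + s *\<^sub>R h) *v h))"
  have "\<exists>t>0. t \<le> 1 \<and> f (u + 1 *\<^sub>R h)
      = (\<Sum>m<2. diff m 0 / fact m * 1 ^ m) + diff 2 t / fact 2 * 1 ^ 2"
  proof (rule Maclaurin2)
    show "\<forall>m t. m < 2 \<and> 0 \<le> t \<and> t \<le> 1 \<longrightarrow> DERIV (diff m) t :> diff (Suc m) t"
      using hessian_line[OF f]
      by (auto simp: diff_def less_2_cases_iff has_real_derivative_iff_has_vector_derivative)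
  qed (auto simp: diff_def)
  with that show ?thesis
    by (auto simp: diff_def numeral_2_eq_2)
qed

section \<open>Bounds for quadratic forms of matrices\<close>

lemma pos_def_lower_bound:
  fixes A :: "real^'n^'n"
  assumes "\<And>v. v \<noteq> 0 \<Longrightarrow> 0 < v \<bullet> (A *v v)"
  obtains \<mu> where "0 < \<mu>" "\<And>v. \<mu> * (norm v)\<^sup>2 \<le> v \<bullet> (A *v v)"
proof -
  \<comment> \<open>The witness for \<open>\<mu>\<close> is the minimum of the quadratic form over
    the compact unit sphere; homogeneity of degree 2 extends the bound to all vectors.\<close>
  have "\<exists>x\<in>sphere 0 1. \<forall>y\<in>sphere 0 1. x \<bullet> (A *v x) \<le> y \<bullet> (A *v y)"
    by (intro continuous_attains_inf continuous_intros) auto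
  then obtain x where x: "norm x = 1"
    and min: "\<And>y. norm y = 1 \<Longrightarrow> x \<bullet> (A *v x) \<le> y \<bullet> (A *v y)"
    by auto
  have "x \<bullet> (A *v x) * (norm v)\<^sup>2 \<le> v \<bullet> (A *v v)" for v
  proof (cases "v = 0")
    case False
    have "x \<bullet> (A *v x) \<le> (v /\<^sub>R norm v) \<bullet> (A *v (v /\<^sub>R norm v))"
      using False by (intro min) simp
    also have "\<dots> = v \<bullet> (A *v v) / (norm v)\<^sup>2"
      by (simp add: matrix_vector_mult_scaleR power2_eq_square divide_inverse)
    finally show ?thesis
      using False by (simp add: pos_le_divide_eq)
  qed simp
  moreover have "0 < x \<bullet> (A *v x)"
    using x by (intro assms) auto
  ultimately show ?thesis using that by blast
qed

lemma matrix_quadratic_form_upper_bound: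
  fixes A :: "real^'n^'n"
  shows "v \<bullet> (A *v v) \<le> onorm ((*v) A) * (norm v)\<^sup>2"
proof -
  have "v \<bullet> (A *v v) \<le> norm v * norm (A *v v)"
    by (rule norm_cauchy_schwarz)
  also have "\<dots> \<le> norm v * (onorm ((*v) A) * norm v)"
    by (intro mult_left_mono onorm matrix_vector_mul_bounded_linear) simp
  finally show ?thesis by (simp add: power2_eq_square mult_ac)
qed

lemma mat_vector_mult: "mat c *v v = c *\<^sub>R v" for v :: "real^'n"
  by (simp add: vec_eq_iff matrix_vector_mult_def mat_def if_distrib[of "\<lambda>x. x * _"]
      cong: if_cong)

section \<open>The entropy density and its production\<close>

text \<open>\<open>source\<close> is the Lipschitz condition for the compact set \<open>{0}\<close>
  combined with \<open>G 0 = 0\<close>, so \<open>L\<close> is the constant belonging to that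
  set.\<close>

locale relaxation_system =
  fixes A :: "real^'n^'n" and F G :: "real^'n \<Rightarrow> real^'n" and \<eta> q :: "real^'n \<Rightarrow> real"
    and \<alpha> \<beta> L :: real
  assumes A: "sym_pos_def A" and F: "smooth_on UNIV F"
    and entropy: "entropy_condition F \<eta> q \<alpha> \<beta>"
    and subchar: "subcharacteristic A F \<eta> \<alpha>"
    and source: "\<And>u. norm (G u) \<le> L * norm u"
begin

lemma alpha_pos: "0 < \<alpha>" and beta_pos: "0 < \<beta>" and smooth_eta: "smooth_on UNIV \<eta>"
  and smooth_q: "smooth_on UNIV q"
  using entropy by (auto simp: entropy_condition_def)

lemma A_symmetric: "v \<bullet> (A *v w) = w \<bullet> (A *v v)"
  using A by (metis dot_lmul_matrix inner_commute sym_pos_def_def transpose_matrix_vector)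

lemma hessian_bounds:
  "\<beta> * (norm v)\<^sup>2 \<le> v \<bullet> (hessian \<eta> u *v v)"
  "v \<bullet> (hessian \<eta> u *v v) \<le> \<alpha> / 2 * (norm v)\<^sup>2"
proof -
  have mat: "v \<bullet> (mat c *v v) = c * (norm v)\<^sup>2" for c :: real
    by (simp add: mat_vector_mult power2_norm_eq_inner)
  show "\<beta> * (norm v)\<^sup>2 \<le> v \<bullet> (hessian \<eta> u *v v)"
    "v \<bullet> (hessian \<eta> u *v v) \<le> \<alpha> / 2 * (norm v)\<^sup>2"
    using entropy mat[of \<beta>] mat[of "\<alpha> / 2"] unfolding entropy_condition_def qf_le_def by metis+
qed

text \<open>At the origin both \<open>\<eta>\<close> and its gradient vanish, so Taylor's formula
  leaves only the quadratic remainder, which the Hessian bounds enclose.\<close>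

lemma eta_bounds:
  "\<beta> / 2 * (norm u)\<^sup>2 \<le> \<eta> u" "\<eta> u \<le> \<alpha> / 4 * (norm u)\<^sup>2"
proof -
  obtain s where "\<eta> (0 + u)
      = \<eta> 0 + row_D \<eta> 0 \<bullet> u + (u \<bullet> (hessian \<eta> (0 + s *\<^sub>R u) *v u)) / 2"
    using smooth_on_taylor[OF smooth_eta] .
  moreover have "\<eta> 0 = 0" "row_D \<eta> 0 = 0"
    using entropy by (auto simp: entropy_condition_def)
  ultimately show "\<beta> / 2 * (norm u)\<^sup>2 \<le> \<eta> u" "\<eta> u \<le> \<alpha> / 4 * (norm u)\<^sup>2"
    using hessian_bounds[of u "0 + s *\<^sub>R u"] by auto
qed

text \<open>Minimising the quadratic Taylor bound of the nonnegative function \<open>\<eta>\<close> over the increment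
  controls the gradient by \<open>\<eta>\<close> itself.\<close>

lemma row_D_eta_le: "(norm (row_D \<eta> u))\<^sup>2 \<le> \<alpha> * \<eta> u"
proof -
  \<comment> \<open>This increment is the zero of the gradient of \<open>h \<mapsto> row_D \<eta> u
    \<bullet> h + \<alpha> / 4 * (norm h)\<^sup>2\<close>.\<close>
  let ?h = "- (2 / \<alpha>) *\<^sub>R row_D \<eta> u"
  obtain s where "\<eta> (u + ?h)
      = \<eta> u + row_D \<eta> u \<bullet> ?h + (?h \<bullet> (hessian \<eta> (u + s *\<^sub>R ?h) *v ?h)) / 2"
    using smooth_on_taylor[OF smooth_eta] .
  moreover have "0 \<le> \<eta> (u + ?h)"
    using entropy unfolding entropy_condition_def by metis
  ultimately have "0 \<le> \<eta> u + row_D \<eta> u \<bullet> ?h + \<alpha> / 4 * (norm ?h)\<^sup>2"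
    using hessian_bounds(2)[of ?h "u + s *\<^sub>R ?h"] by linarith
  also have "\<dots> = \<eta> u - (norm (row_D \<eta> u))\<^sup>2 / \<alpha>"
    using alpha_pos
    by (simp add: dot_square_norm power_mult_distrib field_simps power2_eq_square[of \<alpha>])
  finally show ?thesis
    using alpha_pos by (simp add: field_simps)
qed

lemma norm_row_D_eta_le: "norm (row_D \<eta> u) \<le> \<alpha> / 2 * norm u"
proof (rule power2_le_imp_le)
  have "(norm (row_D \<eta> u))\<^sup>2 \<le> \<alpha> * (\<alpha> / 4 * (norm u)\<^sup>2)"
    using row_D_eta_le[of u] mult_left_mono[OF eta_bounds(2)[of u], of \<alpha>] alpha_pos by linarith
  then show "(norm (row_D \<eta> u))\<^sup>2 \<le> (\<alpha> / 2 * norm u)\<^sup>2"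
    by (simp add: power2_eq_square mult_ac)
qed (use alpha_pos in simp)

definition ent_density :: "real \<Rightarrow> real^'n \<Rightarrow> real^'n \<Rightarrow> real^'n \<Rightarrow> real" where
  "ent_density \<epsilon> u v w =
     \<eta> u + \<epsilon> * (row_D \<eta> u \<bullet> v) + \<epsilon>\<^sup>2 * \<alpha> / 2 * (v \<bullet> v + w \<bullet> (A *v w))"

text \<open>Subtracting the constant \<open>q 0\<close> leaves the \<open>x\<close>-derivative
  unchanged and makes the flux vanish at the zero state. The sign is opposite to the usual one: the
  balance law reads \<open>e_t - j_x = r\<close>.\<close>

definition ent_flux :: "real \<Rightarrow> real^'n \<Rightarrow> real^'n \<Rightarrow> real^'n \<Rightarrow> real" where
  "ent_flux \<epsilon> u v w =
     - (q u - q 0) + \<epsilon> * (row_D \<eta> u \<bullet> (A *v w)) + \<epsilon>\<^sup>2 * \<alpha> * (v \<bullet> (A *v w))"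

text \<open>The formal chain-rule derivative, with free vectors \<open>vt\<close>, \<open>wt\<close>
  in place of \<open>u_tt\<close>, \<open>u_xt\<close>. This turns the entropy production into an
  algebraic inequality between vectors at a single point.\<close>

definition ent_density_dt ::
    "real \<Rightarrow> real^'n \<Rightarrow> real^'n \<Rightarrow> real^'n \<Rightarrow> real^'n \<Rightarrow> real^'n \<Rightarrow> real" where
  "ent_density_dt \<epsilon> u v w vt wt = row_D \<eta> u \<bullet> v
     + \<epsilon> * ((hessian \<eta> u *v v) \<bullet> v + row_D \<eta> u \<bullet> vt) + \<epsilon>\<^sup>2 * \<alpha> * (v \<bullet> vt + w \<bullet> (A *v wt))"

definition ent_flux_dx ::
    "real \<Rightarrow> real^'n \<Rightarrow> real^'n \<Rightarrow> real^'n \<Rightarrow> real^'n \<Rightarrow> real^'n \<Rightarrow> real" where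
  "ent_flux_dx \<epsilon> u v w vx wx = - (row_D q u \<bullet> w)
     + \<epsilon> * ((hessian \<eta> u *v w) \<bullet> (A *v w) + row_D \<eta> u \<bullet> (A *v wx))
     + \<epsilon>\<^sup>2 * \<alpha> * (vx \<bullet> (A *v w) + v \<bullet> (A *v wx))"

text \<open>Cauchy-Schwarz with the gradient bound by \<open>\<eta>\<close>. The right side is kept
  as a product of two square roots so that it can be absorbed into \<open>\<eta> u\<close> and the
  \<open>v \<bullet> v\<close> term of the density.\<close>

lemma row_D_cross_le:
  assumes "0 < \<epsilon>"
  shows "\<bar>\<epsilon> * (row_D \<eta> u \<bullet> v)\<bar> \<le> sqrt (\<eta> u) * (\<epsilon> * sqrt \<alpha> * norm v)"
proof -
  have "norm (row_D \<eta> u) \<le> sqrt (\<alpha> * \<eta> u)"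
    using row_D_eta_le by (simp add: real_le_rsqrt)
  then have "norm (row_D \<eta> u) * norm v \<le> sqrt (\<alpha> * \<eta> u) * norm v"
    by (rule mult_right_mono) simp
  then have "\<bar>row_D \<eta> u \<bullet> v\<bar> \<le> sqrt (\<alpha> * \<eta> u) * norm v"
    using Cauchy_Schwarz_ineq2[of "row_D \<eta> u" v] by linarith
  then have "\<epsilon> * \<bar>row_D \<eta> u \<bullet> v\<bar> \<le> \<epsilon> * (sqrt (\<alpha> * \<eta> u) * norm v)"
    using assms by (intro mult_left_mono) auto
  then show ?thesis
    using assms by (simp add: abs_mult real_sqrt_mult mult_ac)
qed

text \<open>With \<open>a\<^sup>2 = \<eta> u\<close> and
  \<open>b\<^sup>2 = \<alpha> \<epsilon>\<^sup>2 |v|\<^sup>2\<close> the part without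
  \<open>w\<close> lies within \<open>a b\<close> of \<open>a\<^sup>2 + b\<^sup>2 / 2\<close>, and
  \<open>a\<^sup>2 - a b + b\<^sup>2 / 2\<close> is positive definite. All powers of
  \<open>\<epsilon>\<close> sit inside \<open>b\<close>, hence the uniformity.\<close>

lemma ent_density_bounds:
  assumes \<epsilon>: "0 < \<epsilon>"
  shows "\<beta> / 8 * (norm u)\<^sup>2 + \<alpha> / 8 * (\<epsilon>\<^sup>2 * (norm v)\<^sup>2) + \<epsilon>\<^sup>2 * \<alpha> / 2 * (w \<bullet> (A *v w))
      \<le> ent_density \<epsilon> u v w"
    and "ent_density \<epsilon> u v w
      \<le> \<alpha> * (norm u)\<^sup>2 + \<alpha> * (\<epsilon>\<^sup>2 * (norm v)\<^sup>2) + \<epsilon>\<^sup>2 * \<alpha> / 2 * (w \<bullet> (A *v w))"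
proof -
  define a where "a = sqrt (\<eta> u)"
  define b where "b = \<epsilon> * sqrt \<alpha> * norm v"
  have \<eta>: "0 \<le> \<eta> u"
    using eta_bounds(1)[of u] beta_pos by (smt (verit) mult_nonneg_nonneg zero_le_power2 divide_nonneg_pos)
  have a2: "a\<^sup>2 = \<eta> u" using \<eta> by (simp add: a_def)
  have b2: "b\<^sup>2 = \<alpha> * (\<epsilon>\<^sup>2 * (norm v)\<^sup>2)"
    using alpha_pos by (simp add: b_def power_mult_distrib mult_ac)
  have cross: "\<bar>\<epsilon> * (row_D \<eta> u \<bullet> v)\<bar> \<le> a * b"
    using row_D_cross_le[OF \<epsilon>] by (simp add: a_def b_def)
  have eq: "ent_density \<epsilon> u v w
      = a\<^sup>2 + \<epsilon> * (row_D \<eta> u \<bullet> v) + b\<^sup>2 / 2 + \<epsilon>\<^sup>2 * \<alpha> / 2 * (w \<bullet> (A *v w))"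
    by (simp add: ent_density_def a2 b2 power2_norm_eq_inner algebra_simps)
  \<comment> \<open>The weight 2/3 gives \<open>a b \<le> 3/4 a\<^sup>2 + 1/3 b\<^sup>2\<close>;
    rounding 1/3 up to 3/8 leaves \<open>a\<^sup>2 / 4 + b\<^sup>2 / 8\<close> in the lower
    bound.\<close>
  have "(a - 2 / 3 * b)\<^sup>2 = a\<^sup>2 - 4 / 3 * (a * b) + 4 / 9 * b\<^sup>2" "(a - b)\<^sup>2 = a\<^sup>2 - 2 * (a * b) + b\<^sup>2"
    by (simp_all add: power2_eq_square algebra_simps)
  then have "a * b \<le> 3 / 4 * a\<^sup>2 + 3 / 8 * b\<^sup>2" "a * b \<le> a\<^sup>2 / 2 + b\<^sup>2 / 2"
    using zero_le_power2[of "a - 2 / 3 * b"] zero_le_power2[of "a - b"] zero_le_power2[of b]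
    by linarith+
  with cross eq
  have "a\<^sup>2 / 4 + b\<^sup>2 / 8 + \<epsilon>\<^sup>2 * \<alpha> / 2 * (w \<bullet> (A *v w)) \<le> ent_density \<epsilon> u v w"
    "ent_density \<epsilon> u v w \<le> 3 / 2 * a\<^sup>2 + b\<^sup>2 + \<epsilon>\<^sup>2 * \<alpha> / 2 * (w \<bullet> (A *v w))"
    by linarith+
  moreover have "0 \<le> \<alpha> * (norm u)\<^sup>2" using alpha_pos by simp
  ultimately show "\<beta> / 8 * (norm u)\<^sup>2 + \<alpha> / 8 * (\<epsilon>\<^sup>2 * (norm v)\<^sup>2) + \<epsilon>\<^sup>2 * \<alpha> / 2 * (w \<bullet> (A *v w))
      \<le> ent_density \<epsilon> u v w"
    and "ent_density \<epsilon> u v w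
      \<le> \<alpha> * (norm u)\<^sup>2 + \<alpha> * (\<epsilon>\<^sup>2 * (norm v)\<^sup>2) + \<epsilon>\<^sup>2 * \<alpha> / 2 * (w \<bullet> (A *v w))"
    unfolding a2 b2 using eta_bounds[of u] by linarith+
qed

text \<open>Because \<open>A\<close> and the Hessian are both symmetric, the two products in the
  symmetrised matrix have the same quadratic form
  \<open>(?H *v w) \<bullet> (A *v w)\<close>.\<close>

lemma subcharacteristic_dissipation:
  "\<alpha> * (norm (jacobian F (at u) *v w))\<^sup>2 \<le> (hessian \<eta> u *v w) \<bullet> (A *v w)"
proof -
  let ?J = "jacobian F (at u)" and ?H = "hessian \<eta> u"
  let ?M = "(1 / 2) *\<^sub>R (A ** ?H + ?H ** A) - \<alpha> *\<^sub>R (transpose ?J ** ?J)"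
  obtain \<nu> where "0 < \<nu>" "w \<bullet> (mat \<nu> *v w) \<le> w \<bullet> (?M *v w)"
    using subchar unfolding subcharacteristic_def qf_le_def by metis
  then have "0 \<le> w \<bullet> (?M *v w)"
    by (smt (verit) inner_ge_zero inner_scaleR_right mat_vector_mult mult_nonneg_nonneg)
  also have "w \<bullet> (?M *v w)
      = (w \<bullet> (A *v (?H *v w)) + w \<bullet> (?H *v (A *v w))) / 2 - \<alpha> * (w \<bullet> (transpose ?J *v (?J *v w)))"
    by (simp add: matrix_vector_mult_diff_rdistrib matrix_vector_mult_add_rdistrib
        scaleR_matrix_vector_assoc[symmetric] matrix_vector_mul_assoc inner_diff_right inner_add_right)
  also have "w \<bullet> (A *v (?H *v w)) = (?H *v w) \<bullet> (A *v w)"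
    by (rule A_symmetric)
  also have "w \<bullet> (?H *v (A *v w)) = (?H *v w) \<bullet> (A *v w)"
    by (subst hessian_symmetric[OF smooth_eta]) (rule inner_commute)
  also have "w \<bullet> (transpose ?J *v (?J *v w)) = (norm (?J *v w))\<^sup>2"
    by (metis dot_lmul_matrix inner_commute power2_norm_eq_inner transpose_matrix_vector)
  finally show ?thesis by simp
qed

text \<open>Second derivatives enter only through \<open>u_tt - A u_xx\<close>, which the equation
  replaces by first-order terms; what remains is a quadratic form in \<open>v\<close>,
  \<open>w\<close> and the source.\<close>

lemma entropy_production:
  assumes \<epsilon>: "0 < \<epsilon>" and L: "0 < L"
    and pde: "v + jacobian F (at u) *v w = G u + \<epsilon> *\<^sub>R (A *v wx - vt)"
  shows "ent_density_dt \<epsilon> u v w vt vx - ent_flux_dx \<epsilon> u v w vx wx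
    \<le> \<alpha> * L * ((norm u)\<^sup>2 + \<epsilon>\<^sup>2 * (norm v)\<^sup>2)"
proof -
  let ?J = "jacobian F (at u)" and ?H = "hessian \<eta> u"
  define X where "X = vt - A *v wx"
  have X: "\<epsilon> *\<^sub>R X = G u - v - ?J *v w"
    using pde by (simp add: X_def algebra_simps)
  have q: "row_D q u \<bullet> w = row_D \<eta> u \<bullet> (?J *v w)"
    using entropy unfolding entropy_condition_def by (metis dot_lmul_matrix)
  have mixed: "vx \<bullet> (A *v w) = w \<bullet> (A *v vx)"
    by (rule A_symmetric)
  \<comment> \<open>The relation between \<open>\<eta>\<close> and \<open>q\<close> turns the
    entropy flux into \<open>row_D \<eta> u \<bullet> (?J *v w)\<close>, and symmetry of
    \<open>A\<close> cancels the terms containing \<open>vx\<close>.\<close>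
  have "ent_density_dt \<epsilon> u v w vt vx - ent_flux_dx \<epsilon> u v w vx wx
      = row_D \<eta> u \<bullet> (v + ?J *v w + \<epsilon> *\<^sub>R X) + \<epsilon> * (\<alpha> * (v \<bullet> (\<epsilon> *\<^sub>R X)))
        + \<epsilon> * (v \<bullet> (?H *v v) - (?H *v w) \<bullet> (A *v w))"
    unfolding ent_density_dt_def ent_flux_dx_def q mixed X_def
    by (simp add: inner_commute[of "?H *v v" v] algebra_simps power2_eq_square)
  also have "\<dots> = row_D \<eta> u \<bullet> G u + \<alpha> * (\<epsilon> * (v \<bullet> G u))
        + \<epsilon> * (v \<bullet> (?H *v v) - \<alpha> * (v \<bullet> v) - \<alpha> * (v \<bullet> (?J *v w)) - (?H *v w) \<bullet> (A *v w))"
    unfolding X by (simp add: algebra_simps)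
  finally have eq: "ent_density_dt \<epsilon> u v w vt vx - ent_flux_dx \<epsilon> u v w vx wx
      = row_D \<eta> u \<bullet> G u + \<alpha> * (\<epsilon> * (v \<bullet> G u))
        + \<epsilon> * (v \<bullet> (?H *v v) - \<alpha> * (v \<bullet> v) - \<alpha> * (v \<bullet> (?J *v w)) - (?H *v w) \<bullet> (A *v w))" .
  \<comment> \<open>The coefficients of \<open>v \<bullet> v\<close> are \<alpha>/2 from the
    Hessian, -\<alpha> from the test with \<open>\<alpha> u_t\<close>, and \<alpha>/4 from
    completing the square, with sum -\<alpha>/4. The square's other part,
    \<open>\<alpha> |?J w|\<^sup>2\<close>, is absorbed by the subcharacteristic condition.\<close>
  have dissip: "v \<bullet> (?H *v v) - \<alpha> * (v \<bullet> v) - \<alpha> * (v \<bullet> (?J *v w)) - (?H *v w) \<bullet> (A *v w) \<le> 0"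
  proof -
    have "0 \<le> \<alpha> * (norm (v /\<^sub>R 2 + ?J *v w))\<^sup>2"
      using alpha_pos by simp
    also have "\<dots> = \<alpha> / 4 * (v \<bullet> v) + \<alpha> * (v \<bullet> (?J *v w)) + \<alpha> * (norm (?J *v w))\<^sup>2"
      unfolding power2_norm_eq_inner by (simp add: inner_commute[of "?J *v w" v] algebra_simps)
    finally have "- \<alpha> * (v \<bullet> (?J *v w)) \<le> \<alpha> / 4 * (v \<bullet> v) + \<alpha> * (norm (?J *v w))\<^sup>2"
      by simp
    moreover have "0 \<le> \<alpha> * (v \<bullet> v)" using alpha_pos by simp
    ultimately show ?thesis
      using hessian_bounds(2)[of v u] subcharacteristic_dissipation[of u w]
      by (simp add: power2_norm_eq_inner)
  qed
  have G1: "row_D \<eta> u \<bullet> G u \<le> \<alpha> / 2 * norm u * (L * norm u)"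
    using norm_row_D_eta_le[of u] source[of u] alpha_pos
    by (intro order.trans[OF norm_cauchy_schwarz] mult_mono) auto
  have "v \<bullet> G u \<le> norm v * (L * norm u)"
    using source[of u] by (intro order.trans[OF norm_cauchy_schwarz] mult_left_mono) auto
  then have "\<epsilon> * (v \<bullet> G u) \<le> \<epsilon> * (norm v * (L * norm u))"
    using \<epsilon> by (intro mult_left_mono) auto
  also have "\<dots> = L * ((\<epsilon> * norm v) * norm u)"
    by simp
  also have "\<dots> \<le> L * (((\<epsilon> * norm v)\<^sup>2 + (norm u)\<^sup>2) / 2)"
    using sum_squares_bound[of "\<epsilon> * norm v" "norm u"] L by (intro mult_left_mono) auto
  finally have "\<alpha> * (\<epsilon> * (v \<bullet> G u)) \<le> \<alpha> * (L * (((\<epsilon> * norm v)\<^sup>2 + (norm u)\<^sup>2) / 2))"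
    using alpha_pos by (intro mult_left_mono) auto
  moreover have "\<epsilon> * (v \<bullet> (?H *v v) - \<alpha> * (v \<bullet> v) - \<alpha> * (v \<bullet> (?J *v w))
      - (?H *v w) \<bullet> (A *v w)) \<le> 0"
    using dissip \<epsilon> by (simp add: mult_le_0_iff)
  ultimately have "ent_density_dt \<epsilon> u v w vt vx - ent_flux_dx \<epsilon> u v w vx wx
      \<le> \<alpha> / 2 * norm u * (L * norm u) + \<alpha> * (L * (((\<epsilon> * norm v)\<^sup>2 + (norm u)\<^sup>2) / 2))"
    using G1 unfolding eq by linarith
  also have "\<dots> \<le> \<alpha> * L * ((norm u)\<^sup>2 + \<epsilon>\<^sup>2 * (norm v)\<^sup>2)"
  proof -
    have "0 \<le> \<alpha> * (L * (\<epsilon> * norm v)\<^sup>2)"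
      using alpha_pos L by simp
    then show ?thesis
      by (simp add: power2_eq_square algebra_simps add_divide_distrib)
  qed
  finally show ?thesis .
qed

end

section \<open>Integration of the balance law\<close>

text \<open>Integration in \<open>x\<close> reduces \<open>j'\<close> to the end-point fluxes, so
  the integral \<open>I\<close> of \<open>e\<close> satisfies
  \<open>I' \<le> K I + \<delta>\<close>, to which an integrating factor applies.\<close>

lemma localized_gronwall:
  fixes e e' j j' :: "real \<Rightarrow> real \<Rightarrow> real"
  assumes ab: "a \<le> b" and K: "0 \<le> K"
    and e: "\<And>x t. x \<in> {a..b} \<Longrightarrow> t \<in> {0..T} \<Longrightarrow>
      (e x has_real_derivative e' x t) (at t within {0..T})"
    and cont_e: "\<And>t. t \<in> {0..T} \<Longrightarrow> continuous_on {a..b} (\<lambda>x. e x t)"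
    and cont_e': "continuous_on ({0..T} \<times> {a..b}) (\<lambda>(t, x). e' x t)"
    and j: "\<And>x t. x \<in> {a..b} \<Longrightarrow> t \<in> {0..T} \<Longrightarrow>
      ((\<lambda>x. j x t) has_real_derivative j' x t) (at x within {a..b})"
    and ineq: "\<And>x t. x \<in> {a..b} \<Longrightarrow> t \<in> {0..T} \<Longrightarrow> e' x t - j' x t \<le> K * e x t"
    and flux: "\<And>t. t \<in> {0..T} \<Longrightarrow> j b t - j a t \<le> \<delta>" and \<delta>: "0 \<le> \<delta>"
    and t: "t \<in> {0..T}"
  shows "integral {a..b} (\<lambda>x. e x t) \<le> exp (K * t) * (integral {a..b} (\<lambda>x. e x 0) + \<delta> * t)"
proof -
  define I where "I s = integral {a..b} (\<lambda>x. e x s)" for s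
  define I' where "I' s = integral {a..b} (\<lambda>x. e' x s)" for s
  have I: "(I has_real_derivative I' s) (at s within {0..T})" if "s \<in> {0..T}" for s
    unfolding I_def I'_def cbox_interval[symmetric]
    using that by (intro leibniz_rule_field_derivative)
      (auto intro!: e integrable_continuous_real cont_e cont_e')
  have I'_le: "I' s \<le> K * I s + \<delta>" if s: "s \<in> {0..T}" for s
  proof -
    have j': "((\<lambda>x. j' x s) has_integral j b s - j a s) {a..b}"
      using j[OF _ s] ab
      by (intro fundamental_theorem_of_calculus)
        (auto simp: has_real_derivative_iff_has_vector_derivative)
    have e_int: "(\<lambda>x. e x s) integrable_on {a..b}"
      using cont_e[OF s] by (rule integrable_continuous_real)
    have "continuous_on {a..b} (\<lambda>x. e' x s)"
      using continuous_on_compose2[OF cont_e', of "{a..b}" "\<lambda>x. (s, x)"] s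
      by (simp add: image_subset_iff continuous_on_Pair continuous_on_const continuous_on_id)
    then have "((\<lambda>x. e' x s) has_integral I' s) {a..b}"
      unfolding I'_def by (intro integrable_integral integrable_continuous_real)
    moreover have "((\<lambda>x. j' x s + K * e x s) has_integral (j b s - j a s) + K * I s) {a..b}"
      unfolding I_def by (intro has_integral_add has_integral_mult_right integrable_integral j' e_int)
    ultimately have "I' s \<le> (j b s - j a s) + K * I s"
    proof (rule has_integral_le)
      show "e' x s \<le> j' x s + K * e x s" if "x \<in> {a..b}" for x
        using ineq[OF that s] by linarith
    qed
    also have "\<dots> \<le> K * I s + \<delta>"
      using flux[OF s] by simp
    finally show ?thesis .
  qed
  \<comment> \<open>Subtracting \<open>\<delta> * s\<close> absorbs the flux error:
    \<open>exp (- (K * s))\<close> is at most 1, so the derivative of \<open>?h\<close> is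
    nonpositive. Only interior points are tested, where the one-sided derivative of \<open>I\<close>
    is two-sided.\<close>
  let ?h = "\<lambda>s. exp (- (K * s)) * I s - \<delta> * s"
  have "?h t \<le> ?h 0"
  proof (rule DERIV_nonpos_imp_decreasing_open[where f = ?h])
    show "0 \<le> t" using t by simp
    have "continuous_on {0..T} I"
      using I by (intro continuous_on_vector_derivative)
        (auto simp: has_real_derivative_iff_has_vector_derivative)
    then have "continuous_on {0..t} I"
      using t by (auto intro: continuous_on_subset)
    then show "continuous_on {0..t} ?h"
      by (intro continuous_intros)
    fix s assume s: "0 < s" "s < t"
    then have sT: "s \<in> {0..T}" "0 < s" "s < T" using t by auto
    have "(I has_real_derivative I' s) (at s)"
      using I[OF sT(1)] sT by (simp add: at_within_Icc_at)
    then have "(?h has_real_derivative exp (- (K * s)) * (I' s - K * I s) - \<delta>) (at s)"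
      by (auto intro!: derivative_eq_intros simp: algebra_simps)
    moreover have "exp (- (K * s)) * (I' s - K * I s) \<le> 1 * \<delta>"
    proof (rule order.trans)
      show "exp (- (K * s)) * (I' s - K * I s) \<le> exp (- (K * s)) * \<delta>"
        using I'_le[OF sT(1)] by (intro mult_left_mono) auto
      show "exp (- (K * s)) * \<delta> \<le> 1 * \<delta>"
        using \<delta> K s by (intro mult_right_mono) auto
    qed
    ultimately show "\<exists>y. (?h has_real_derivative y) (at s) \<and> y \<le> 0"
      by (intro exI conjI) auto
  qed
  then have "exp (- (K * t)) * I t \<le> I 0 + \<delta> * t" by simp
  then have le: "exp (K * t) * (exp (- (K * t)) * I t) \<le> exp (K * t) * (I 0 + \<delta> * t)"
    by (intro mult_left_mono) auto
  have "I t = exp (K * t) * (exp (- (K * t)) * I t)"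
    by (simp add: exp_minus)
  also note le
  finally show ?thesis
    unfolding I_def .
qed

text \<open>Passes from the gauge integrals over bounded intervals in the Gronwall step to the
  Lebesgue integral in \<open>energy\<close>, by dominated convergence with majorant
  \<open>|f|\<close>.\<close>

lemma tendsto_integral_symmetric_interval:
  fixes f :: "real \<Rightarrow> real"
  assumes f: "integrable lborel f"
  shows "(\<lambda>n. integral {- real n..real n} f) \<longlonglongrightarrow> (LINT x|lborel. f x)"
proof -
  have "(\<lambda>n. LINT x|lborel. indicator {- real n..real n} x *\<^sub>R f x) \<longlonglongrightarrow> (LINT x|lborel. f x)"
  proof (rule integral_dominated_convergence[where w="\<lambda>x. norm (f x)"])
    show "AE x in lborel. (\<lambda>n. indicator {- real n..real n} x *\<^sub>R f x) \<longlonglongrightarrow> f x"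
    proof (rule AE_I2)
      fix x :: real
      have "\<forall>\<^sub>F n in sequentially. indicator {- real n..real n} x *\<^sub>R f x = f x"
        using eventually_ge_at_top[of "nat \<lceil>\<bar>x\<bar>\<rceil>"]
        by eventually_elim (auto simp: indicator_def abs_le_iff nat_le_iff ceiling_le_iff)
      then show "(\<lambda>n. indicator {- real n..real n} x *\<^sub>R f x) \<longlonglongrightarrow> f x"
        by (rule tendsto_eventually)
    qed
  qed (use f in \<open>auto simp: indicator_def\<close>)
  moreover have "(LINT x|lborel. indicator {- real n..real n} x *\<^sub>R f x)
      = integral {- real n..real n} f" for n
    using set_borel_integral_eq_integral(2)[of "{- real n..real n}" f]
      set_integrable_subset[of lborel UNIV f "{- real n..real n}"] f
    by (simp add: set_lebesgue_integral_def set_integrable_def)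
  ultimately show ?thesis by simp
qed

section \<open>Entropy density and flux along a solution: derivatives, continuity, decay\<close>

lemma has_vector_derivative_compose_smooth:
  assumes f: "smooth_on UNIV f" and U: "(U has_vector_derivative u') (at t within S)"
  shows "((\<lambda>s. f (U s)) has_vector_derivative row_D f (U t) \<bullet> u') (at t within S)"
    and "((\<lambda>s. row_D f (U s)) has_vector_derivative hessian f (U t) *v u') (at t within S)"
  using has_derivative_compose[OF U[unfolded has_vector_derivative_def] smooth_on_has_row_D[OF f]]
    has_derivative_compose[OF U[unfolded has_vector_derivative_def] smooth_on_has_hessian[OF f]]
  by (simp_all add: has_vector_derivative_def matrix_vector_mult_scaleR)

lemmas has_vector_derivative_inner [derivative_intros] =
  bounded_bilinear.has_vector_derivative[OF bounded_bilinear_inner]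

context relaxation_system
begin

text \<open>The assumption that \<open>U\<close> has derivative \<open>V t\<close> encodes
  \<open>v = u_t\<close>; symmetry of \<open>A\<close> merges the two terms from
  \<open>w \<bullet> A w\<close>. In \<open>ent_flux_has_dx\<close> the derivative of
  \<open>U\<close> is \<open>W x\<close> instead, encoding \<open>w = u_x\<close>.\<close>

lemma ent_density_has_dt:
  assumes U: "(U has_vector_derivative V t) (at t within S)"
    and V: "(V has_vector_derivative vt) (at t within S)"
    and W: "(W has_vector_derivative wt) (at t within S)"
  shows "((\<lambda>s. ent_density \<epsilon> (U s) (V s) (W s)) has_vector_derivative
    ent_density_dt \<epsilon> (U t) (V t) (W t) vt wt) (at t within S)"
  unfolding ent_density_def ent_density_dt_def
  by (rule derivative_eq_intros bounded_linear.has_vector_derivative[OF bounded_linear_mult_right]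
      bounded_linear.has_vector_derivative[OF matrix_vector_mul_bounded_linear]
      has_vector_derivative_inner
      has_vector_derivative_compose_smooth[OF smooth_eta] U V W refl)+
    (simp add: A_symmetric[of wt] inner_commute[of vt] algebra_simps)

lemma ent_flux_has_dx:
  assumes U: "(U has_vector_derivative W x) (at x within S)"
    and V: "(V has_vector_derivative vx) (at x within S)"
    and W: "(W has_vector_derivative wx) (at x within S)"
  shows "((\<lambda>s. ent_flux \<epsilon> (U s) (V s) (W s)) has_vector_derivative
    ent_flux_dx \<epsilon> (U x) (V x) (W x) vx wx) (at x within S)"
  unfolding ent_flux_def ent_flux_dx_def
  by (rule derivative_eq_intros bounded_linear.has_vector_derivative[OF bounded_linear_mult_right]
      bounded_linear.has_vector_derivative[OF matrix_vector_mul_bounded_linear]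
      has_vector_derivative_inner
      has_vector_derivative_compose_smooth[OF smooth_eta]
      has_vector_derivative_compose_smooth[OF smooth_q] U V W refl)+
    (simp add: algebra_simps)

lemma continuous_on_entropy_data:
  "continuous_on UNIV \<eta>" "continuous_on UNIV q" "continuous_on UNIV (row_D \<eta>)"
  "continuous_on UNIV (hessian \<eta>)"
  using smooth_eta smooth_q
  by (simp_all add: smooth_on_imp_continuous_on continuous_on_row_D continuous_on_hessian)

lemma continuous_on_ent:
  assumes [continuous_intros]: "continuous_on S U" "continuous_on S V" "continuous_on S W"
  shows "continuous_on S (\<lambda>p. ent_density \<epsilon> (U p) (V p) (W p))"
    and "continuous_on S (\<lambda>p. ent_flux \<epsilon> (U p) (V p) (W p))"
    and "continuous_on S V' \<Longrightarrow> continuous_on S W' \<Longrightarrow>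
      continuous_on S (\<lambda>p. ent_density_dt \<epsilon> (U p) (V p) (W p) (V' p) (W' p))"
  unfolding ent_density_def ent_flux_def ent_density_dt_def
  by (intro continuous_intros continuous_on_compose2[OF continuous_on_entropy_data(1)]
      continuous_on_compose2[OF continuous_on_entropy_data(2)]
      continuous_on_compose2[OF continuous_on_entropy_data(3)]
      continuous_on_compose2[OF continuous_on_entropy_data(4)] subset_UNIV)+

text \<open>The flux is a continuous function of \<open>(u, u_t, u_x)\<close> vanishing at the
  origin, and this triple tends to \<open>0\<close> uniformly in \<open>t\<close>. Each entry is
  kept below \<open>d / 3\<close> so that the triple stays within \<open>d\<close>.\<close>

lemma ent_flux_uniformly_small:
  fixes u :: "real \<times> real \<Rightarrow> real^'n"
  assumes decay: "decays_fast T u" and \<delta>: "0 < \<delta>"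
  shows "\<forall>\<^sub>F x in at_infinity. \<forall>t\<in>{0..T}.
    \<bar>ent_flux \<epsilon> (u (x, t)) (dt T u (x, t)) (dx u (x, t))\<bar> < \<delta>"
proof -
  let ?\<Phi> = "\<lambda>p. ent_flux \<epsilon> (fst p) (fst (snd p)) (snd (snd p))"
  have "continuous_on UNIV ?\<Phi>"
    by (intro continuous_on_ent(2) continuous_intros)
  then have "isCont ?\<Phi> 0"
    by (rule continuous_on_interior) simp
  then obtain d where d: "0 < d" and small: "\<And>p. dist p 0 < d \<Longrightarrow> dist (?\<Phi> p) (?\<Phi> 0) < \<delta>"
    using \<delta> unfolding continuous_at_eps_delta by (auto simp: dist_norm)
  have lim: "\<forall>\<^sub>F x in at_infinity. \<forall>t\<in>{0..T}. norm ((dx ^^ j) ((dt T ^^ k) u) (x, t)) < d / 3" for j k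
  proof -
    have "uniform_limit {0..T} (\<lambda>x t. (dx ^^ j) ((dt T ^^ k) u) (x, t)) (\<lambda>t. 0) at_infinity"
      using decay unfolding decays_fast_def by blast
    from uniform_limitD[OF this, of "d / 3"] d show ?thesis by simp
  qed
  show ?thesis
    using lim[of 0 0] lim[of 0 1] lim[of 1 0]
  proof eventually_elim
    case (elim x)
    show ?case
    proof
      fix t assume t: "t \<in> {0..T}"
      let ?p = "(u (x, t), dt T u (x, t), dx u (x, t))"
      have "norm ?p \<le> norm (u (x, t)) + (norm (dt T u (x, t)) + norm (dx u (x, t)))"
        by (intro order.trans[OF norm_Pair_le] add_left_mono norm_Pair_le)
      also have "\<dots> < d"
        using elim t by fastforce
      finally have "dist (?\<Phi> ?p) (?\<Phi> 0) < \<delta>"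
        by (intro small) (simp add: dist_norm)
      moreover have "?\<Phi> 0 = 0"
        by (simp add: ent_flux_def)
      ultimately show "\<bar>ent_flux \<epsilon> (u (x, t)) (dt T u (x, t)) (dx u (x, t))\<bar> < \<delta>"
        by (simp add: dist_norm)
    qed
  qed
qed

lemma dx_compose_F:
  assumes "smooth_on (strip T) u" "t \<in> {0..T}"
  shows "dx (\<lambda>p. F (u p)) (x, t) = jacobian F (at (u (x, t))) *v dx u (x, t)"
proof -
  have J: "(F has_derivative (\<lambda>h. jacobian F (at (u (x, t))) *v h)) (at (u (x, t)))"
    using smooth_on_imp_differentiable_on[OF F]
    by (simp add: differentiable_on_def flip: jacobian_works)
  have "((\<lambda>y. F (u (y, t))) has_vector_derivative
      jacobian F (at (u (x, t))) *v dx u (x, t)) (at x)"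
    using has_derivative_compose[OF
        smooth_on_strip_has_dx(1)[OF assms, of x, unfolded has_vector_derivative_def] J]
    by (simp add: has_vector_derivative_def matrix_vector_mult_scaleR)
  then show ?thesis
    by (simp add: dx_def vector_derivative_at)
qed

end

text \<open>Square-integrable majorants dominate the squares; continuity in \<open>x\<close>
  provides measurability.\<close>

lemma decays_fast_integrable:
  fixes u :: "real \<times> real \<Rightarrow> 'a::euclidean_space"
  assumes u: "smooth_on (strip T) u" "decays_fast T u" and T: "0 < T" and t: "t \<in> {0..T}"
  shows "integrable lborel (\<lambda>x. (norm (u (x, t)))\<^sup>2)"
    and "integrable lborel (\<lambda>x. (norm (dx u (x, t)))\<^sup>2)"
    and "integrable lborel (\<lambda>x. (norm (dt T u (x, t)))\<^sup>2)"
proof -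
  have *: "integrable lborel (\<lambda>x. (norm (w (x, t)))\<^sup>2)"
    if w: "smooth_on (strip T) w" "w = (dx ^^ j) ((dt T ^^ k) u)" "j + k \<le> 2" for w j k
  proof -
    obtain g where g: "integrable lborel (\<lambda>x. (g x)\<^sup>2)" "\<And>x. norm (w (x, t)) \<le> g x"
      using u(2) w(2,3) t unfolding decays_fast_def by blast
    show ?thesis
    proof (rule Bochner_Integration.integrable_bound[OF g(1)])
      have "continuous_on UNIV (\<lambda>x. w (x, t))"
        using t by (intro continuous_on_compose2[OF smooth_on_imp_continuous_on[OF w(1)]])
          (auto intro!: continuous_intros)
      then have "continuous_on UNIV (\<lambda>x. (norm (w (x, t)))\<^sup>2)"
        by (intro continuous_intros)
      then show "(\<lambda>x. (norm (w (x, t)))\<^sup>2) \<in> borel_measurable lborel"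
        by (simp add: borel_measurable_continuous_onI)
      show "AE x in lborel. norm ((norm (w (x, t)))\<^sup>2) \<le> norm ((g x)\<^sup>2)"
        using g(2) by (intro AE_I2) (simp add: power_mono)
    qed
  qed
  show "integrable lborel (\<lambda>x. (norm (u (x, t)))\<^sup>2)"
    "integrable lborel (\<lambda>x. (norm (dx u (x, t)))\<^sup>2)"
    "integrable lborel (\<lambda>x. (norm (dt T u (x, t)))\<^sup>2)"
    by (rule *[of u 0 0] *[of "dx u" 1 0] *[of "dt T u" 0 1];
        simp add: u(1) smooth_on_strip_dx[OF u(1)] smooth_on_strip_dt[OF T u(1)])+
qed

section \<open>The energy estimate for fixed \<epsilon>\<close>

context relaxation_system
begin

lemma energy_estimate:
  assumes \<epsilon>: "0 < \<epsilon>" and L: "0 < L" and T: "0 < T"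
    and sm: "smooth_on (strip T) u" and sol: "solves A F G T \<epsilon> u" and decay: "decays_fast T u"
    and \<mu>: "\<And>w. \<mu> * (norm w)\<^sup>2 \<le> w \<bullet> (A *v w)"
    and \<Lambda>: "0 \<le> \<Lambda>" "\<And>w. w \<bullet> (A *v w) \<le> \<Lambda> * (norm w)\<^sup>2"
    and c: "0 < c" "c \<le> \<beta> / 8" "c \<le> \<alpha> / 8" "c \<le> \<alpha> / 2 * \<mu>"
    and t: "t \<in> {0..T}"
  shows "energy T \<epsilon> u t \<le> exp (\<alpha> * L / c * T) * (\<alpha> * (1 + \<Lambda>)) / c * energy T \<epsilon> u 0"
proof -
  define e where "e x s = ent_density \<epsilon> (u (x, s)) (dt T u (x, s)) (dx u (x, s))" for x s
  define e' where "e' x s = ent_density_dt \<epsilon> (u (x, s)) (dt T u (x, s)) (dx u (x, s))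
      (dt T (dt T u) (x, s)) (dx (dt T u) (x, s))" for x s
  define j where "j x s = ent_flux \<epsilon> (u (x, s)) (dt T u (x, s)) (dx u (x, s))" for x s
  define j' where "j' x s = ent_flux_dx \<epsilon> (u (x, s)) (dt T u (x, s)) (dx u (x, s))
      (dx (dt T u) (x, s)) (dx (dx u) (x, s))" for x s
  define \<phi> where "\<phi> s x = (norm (u (x, s)))\<^sup>2 + \<epsilon>\<^sup>2 * (norm (dx u (x, s)))\<^sup>2
      + \<epsilon>\<^sup>2 * (norm (dt T u (x, s)))\<^sup>2" for s x
  note smx = smooth_on_strip_dx[OF sm] and smt = smooth_on_strip_dt[OF T sm]
  \<comment> \<open>\<open>K\<close> converts the production bound
    \<open>\<alpha> * L * \<phi>\<close> into a multiple of \<open>e\<close> through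
    \<open>c * \<phi> \<le> e\<close>; \<open>C2\<close> exceeds both \<open>\<alpha>\<close> and
    \<open>\<alpha> * \<Lambda> / 2\<close>, the coefficients in the upper bound.\<close>
  define K where "K = \<alpha> * L / c"
  define C2 where "C2 = \<alpha> * (1 + \<Lambda>)"
  have K: "0 \<le> K" and C2: "0 < C2"
    using alpha_pos L c(1) \<Lambda>(1) by (simp_all add: K_def C2_def)

  have low: "c * \<phi> s x \<le> e x s" for s x
  proof -
    have "c * (norm (u (x, s)))\<^sup>2 \<le> \<beta> / 8 * (norm (u (x, s)))\<^sup>2"
      "c * (\<epsilon>\<^sup>2 * (norm (dt T u (x, s)))\<^sup>2) \<le> \<alpha> / 8 * (\<epsilon>\<^sup>2 * (norm (dt T u (x, s)))\<^sup>2)"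
      using c by (intro mult_right_mono; simp)+
    moreover have "c * (\<epsilon>\<^sup>2 * (norm (dx u (x, s)))\<^sup>2)
        \<le> \<epsilon>\<^sup>2 * \<alpha> / 2 * (dx u (x, s) \<bullet> (A *v dx u (x, s)))"
    proof -
      have "c * (\<epsilon>\<^sup>2 * (norm (dx u (x, s)))\<^sup>2) \<le> (\<alpha> / 2 * \<mu>) * (\<epsilon>\<^sup>2 * (norm (dx u (x, s)))\<^sup>2)"
        using c by (intro mult_right_mono) auto
      also have "\<dots> = \<epsilon>\<^sup>2 * \<alpha> / 2 * (\<mu> * (norm (dx u (x, s)))\<^sup>2)"
        by simp
      also have "\<dots> \<le> \<epsilon>\<^sup>2 * \<alpha> / 2 * (dx u (x, s) \<bullet> (A *v dx u (x, s)))"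
        using alpha_pos by (intro mult_left_mono \<mu>) auto
      finally show ?thesis .
    qed
    ultimately show ?thesis
      using ent_density_bounds(1)[OF \<epsilon>, of "u (x, s)" "dt T u (x, s)" "dx u (x, s)"]
      by (simp add: \<phi>_def e_def distrib_left)
  qed
  have up: "e x s \<le> C2 * \<phi> s x" for s x
  proof -
    have "\<epsilon>\<^sup>2 * \<alpha> / 2 * (dx u (x, s) \<bullet> (A *v dx u (x, s)))
        \<le> \<epsilon>\<^sup>2 * \<alpha> / 2 * (\<Lambda> * (norm (dx u (x, s)))\<^sup>2)"
      using alpha_pos by (intro mult_left_mono \<Lambda>) auto
    also have "\<dots> = (\<alpha> * \<Lambda> / 2) * (\<epsilon>\<^sup>2 * (norm (dx u (x, s)))\<^sup>2)"
      by simp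
    also have "\<dots> \<le> C2 * (\<epsilon>\<^sup>2 * (norm (dx u (x, s)))\<^sup>2)"
      using alpha_pos \<Lambda>(1) by (intro mult_right_mono) (auto simp: C2_def field_simps)
    finally have "\<epsilon>\<^sup>2 * \<alpha> / 2 * (dx u (x, s) \<bullet> (A *v dx u (x, s)))
        \<le> C2 * (\<epsilon>\<^sup>2 * (norm (dx u (x, s)))\<^sup>2)" .
    moreover have "\<alpha> * (norm (u (x, s)))\<^sup>2 \<le> C2 * (norm (u (x, s)))\<^sup>2"
      "\<alpha> * (\<epsilon>\<^sup>2 * (norm (dt T u (x, s)))\<^sup>2) \<le> C2 * (\<epsilon>\<^sup>2 * (norm (dt T u (x, s)))\<^sup>2)"
      using alpha_pos \<Lambda>(1) by (intro mult_right_mono; simp add: C2_def)+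
    ultimately show ?thesis
      using ent_density_bounds(2)[OF \<epsilon>, of "u (x, s)" "dt T u (x, s)" "dx u (x, s)"]
      by (simp add: \<phi>_def e_def distrib_left)
  qed

  have e_deriv: "(e x has_real_derivative e' x s) (at s within {0..T})" if "s \<in> {0..T}" for x s
    unfolding has_real_derivative_iff_has_vector_derivative e_def e'_def
    by (rule ent_density_has_dt smooth_on_strip_has_dt(1)[OF sm that T]
        smooth_on_strip_has_dt(1)[OF smt that T] smooth_on_strip_has_dt_dx[OF sm that T])+
  have j_deriv: "((\<lambda>x. j x s) has_real_derivative j' x s) (at x within S)"
    if "s \<in> {0..T}" for x s S
    unfolding has_real_derivative_iff_has_vector_derivative j_def j'_def
    by (rule has_vector_derivative_at_within, rule ent_flux_has_dx smooth_on_strip_has_dx(1)[OF sm that]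
        smooth_on_strip_has_dx(1)[OF smt that] smooth_on_strip_has_dx(1)[OF smx that])+
  have production: "e' x s - j' x s \<le> K * e x s" if s: "s \<in> {0..T}" for x s
  proof -
    have "dt T u (x, s) + jacobian F (at (u (x, s))) *v dx u (x, s)
        = G (u (x, s)) + \<epsilon> *\<^sub>R (A *v dx (dx u) (x, s) - dt T (dt T u) (x, s))"
      using sol s unfolding solves_def dx_compose_F[OF sm s, symmetric] by simp
    then have "e' x s - j' x s
        \<le> \<alpha> * L * ((norm (u (x, s)))\<^sup>2 + \<epsilon>\<^sup>2 * (norm (dt T u (x, s)))\<^sup>2)"
      unfolding e'_def j'_def by (rule entropy_production[OF \<epsilon> L])
    also have "\<dots> \<le> \<alpha> * L * \<phi> s x"
      using alpha_pos L by (intro mult_left_mono) (auto simp: \<phi>_def)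
    also have "\<dots> = K * (c * \<phi> s x)"
      using c(1) by (simp add: K_def)
    also have "\<dots> \<le> K * e x s"
      using K by (intro mult_left_mono low)
    finally show ?thesis .
  qed
  have cont_strip: "continuous_on (strip T) (\<lambda>p. e (fst p) (snd p))"
    "continuous_on (strip T) (\<lambda>p. e' (fst p) (snd p))"
    unfolding e_def e'_def prod.collapse
    by (rule continuous_on_ent; rule smooth_on_imp_continuous_on,
        fact sm smx smt smooth_on_strip_dx[OF smt] smooth_on_strip_dt[OF T smt])+
  have cont_e: "continuous_on {a..b} (\<lambda>x. e x s)" if "s \<in> {0..T}" for a b s
    using continuous_on_compose2[OF cont_strip(1), of "{a..b}" "\<lambda>x. (x, s)"] that
    by (simp add: image_subset_iff continuous_on_Pair continuous_on_const continuous_on_id)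
  \<comment> \<open>The Gronwall lemma takes pairs in the order \<open>(t, x)\<close>, the strip in
    the order \<open>(x, t)\<close>; hence the swap.\<close>
  have cont_e': "continuous_on ({0..T} \<times> {a..b}) (\<lambda>(s, x). e' x s)" for a b
    using continuous_on_compose2[OF cont_strip(2), of "{0..T} \<times> {a..b}" prod.swap]
    by (auto simp: split_beta image_subset_iff continuous_on_swap strip_def)

  have int\<phi>: "integrable lborel (\<phi> s)" if "s \<in> {0..T}" for s
    unfolding \<phi>_def using decays_fast_integrable[OF sm decay T that]
    by (intro Bochner_Integration.integrable_add integrable_mult_right)
  have hk: "\<phi> s integrable_on {a..b}" if "s \<in> {0..T}" for s a b
    using int\<phi>[OF that] by (meson integrable_on_lborel integrable_on_subinterval subset_UNIV)
  have energy: "energy T \<epsilon> u s = (LINT x|lborel. \<phi> s x)" for s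
    by (simp add: energy_def \<phi>_def)
  have T0: "0 \<in> {0..T}" using T by simp
  have \<phi>0: "0 \<le> \<phi> s x" for s x by (simp add: \<phi>_def)

  have bound: "c * integral {- real n..real n} (\<phi> t)
      \<le> exp (K * T) * (C2 * energy T \<epsilon> u 0 + \<delta> * T)"
    if \<delta>: "0 < \<delta>" and flux: "\<And>s. s \<in> {0..T} \<Longrightarrow> j (real n) s - j (- real n) s \<le> \<delta>" for \<delta> n
  proof -
    let ?I = "{- real n..real n}"
    have "c * integral ?I (\<phi> t) = integral ?I (\<lambda>x. c * \<phi> t x)"
      by simp
    also have "\<dots> \<le> integral ?I (\<lambda>x. e x t)"
      using low by (intro integral_le integrable_on_mult_right hk[OF t] integrable_continuous_real
          cont_e[OF t])
    also have "\<dots> \<le> exp (K * t) * (integral ?I (\<lambda>x. e x 0) + \<delta> * t)"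
      by (rule localized_gronwall[where e'=e' and j=j and j'=j' and T=T])
        (use K \<delta> t in \<open>auto intro: e_deriv cont_e cont_e' j_deriv production flux\<close>)
    finally have 1: "c * integral ?I (\<phi> t) \<le> exp (K * t) * (integral ?I (\<lambda>x. e x 0) + \<delta> * t)" .
    have "integral ?I (\<lambda>x. e x 0) \<le> integral ?I (\<lambda>x. C2 * \<phi> 0 x)"
      using up by (intro integral_le integrable_on_mult_right hk[OF T0] integrable_continuous_real
          cont_e[OF T0])
    also have "\<dots> = C2 * integral ?I (\<phi> 0)"
      by simp
    also have "\<dots> \<le> C2 * integral UNIV (\<phi> 0)"
      using int\<phi>[OF T0] \<phi>0 hk[OF T0] C2
      by (intro mult_left_mono integral_subset_le) (auto simp: integrable_on_lborel)
    also have "integral UNIV (\<phi> 0) = energy T \<epsilon> u 0"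
      using int\<phi>[OF T0] by (simp add: energy integral_lborel)
    finally have 2: "integral ?I (\<lambda>x. e x 0) \<le> C2 * energy T \<epsilon> u 0" .
    \<comment> \<open>Nonnegativity allows \<open>exp (K * t)\<close> to be enlarged to
      \<open>exp (K * T)\<close> in the product.\<close>
    have "0 \<le> integral ?I (\<lambda>x. e x 0)"
    proof (rule integral_nonneg)
      show "(\<lambda>x. e x 0) integrable_on ?I"
        by (intro integrable_continuous_real cont_e[OF T0])
      show "0 \<le> e x 0" for x
        using low[where s=0] \<phi>0[of 0 x] c(1) by (meson mult_nonneg_nonneg less_imp_le order.trans)
    qed
    then have "exp (K * t) * (integral ?I (\<lambda>x. e x 0) + \<delta> * t)
        \<le> exp (K * T) * (C2 * energy T \<epsilon> u 0 + \<delta> * T)"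
      using K t \<delta> 2 by (intro mult_mono add_mono) (auto intro: mult_left_mono)
    with 1 show ?thesis by linarith
  qed
  \<comment> \<open>First limit: \<delta> is fixed and \<open>n\<close> grows. Once \<open>n\<close>
    passes \<open>r\<close>, each end point contributes less than \<open>\<delta> / 2\<close> to the
    flux.\<close>
  have "c * energy T \<epsilon> u t \<le> exp (K * T) * (C2 * energy T \<epsilon> u 0 + \<delta> * T)" if \<delta>: "0 < \<delta>" for \<delta>
  proof (rule tendsto_upperbound)
    show "(\<lambda>n. c * integral {- real n..real n} (\<phi> t)) \<longlonglongrightarrow> c * energy T \<epsilon> u t"
      unfolding energy by (intro tendsto_mult_left tendsto_integral_symmetric_interval int\<phi> t)
    have "\<forall>\<^sub>F x in at_infinity. \<forall>s\<in>{0..T}. \<bar>j x s\<bar> < \<delta> / 2"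
      unfolding j_def using ent_flux_uniformly_small[OF decay, of "\<delta> / 2"] \<delta> by simp
    then obtain r where r: "\<And>x s. r \<le> \<bar>x\<bar> \<Longrightarrow> s \<in> {0..T} \<Longrightarrow> \<bar>j x s\<bar> < \<delta> / 2"
      unfolding eventually_at_infinity real_norm_def by meson
    show "\<forall>\<^sub>F n in sequentially. c * integral {- real n..real n} (\<phi> t)
        \<le> exp (K * T) * (C2 * energy T \<epsilon> u 0 + \<delta> * T)"
      using eventually_ge_at_top[of "nat \<lceil>r\<rceil>"]
    proof eventually_elim
      case (elim n)
      then have r_le: "r \<le> real n" by linarith
      show ?case
      proof (rule bound[OF \<delta>])
        show "j (real n) s - j (- real n) s \<le> \<delta>" if "s \<in> {0..T}" for s
          using r[OF _ that, of "real n"] r[OF _ that, of "- real n"] r_le by simp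
      qed
    qed
  qed simp
  \<comment> \<open>Second limit: the left side no longer involves \<delta>, so \<delta> may tend to
    0 from the right.\<close>
  then have "\<forall>\<^sub>F \<delta> in at_right 0. c * energy T \<epsilon> u t \<le> exp (K * T) * (C2 * energy T \<epsilon> u 0 + \<delta> * T)"
    using eventually_at_right_less[of "0 :: real"] by (rule eventually_mono[rotated])
  moreover have "((\<lambda>\<delta>. exp (K * T) * (C2 * energy T \<epsilon> u 0 + \<delta> * T)) \<longlongrightarrow>
      exp (K * T) * (C2 * energy T \<epsilon> u 0 + 0 * T)) (at_right 0)"
    by (intro tendsto_intros)
  ultimately have "c * energy T \<epsilon> u t \<le> exp (K * T) * (C2 * energy T \<epsilon> u 0 + 0 * T)"
    by (intro tendsto_lowerbound) auto
  then show ?thesis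
    using c(1) by (simp add: K_def C2_def field_simps)
qed

end

section \<open>Choice of a constant uniform in \<epsilon> and in the system\<close>

theorem proposition3p1p3:
  fixes A :: "real^'n^'n" and \<alpha> \<beta> T L :: real
  assumes "sym_pos_def A" and "0 < T"
  shows "\<exists>C>0. \<forall>(F :: real^'n \<Rightarrow> real^'n) G \<eta> q \<L> (u :: real \<Rightarrow> real \<times> real \<Rightarrow> real^'n).
     smooth_on UNIV F \<longrightarrow> continuous_on UNIV G \<longrightarrow> G 0 = 0 \<longrightarrow>
     entropy_condition F \<eta> q \<alpha> \<beta> \<longrightarrow>
     subcharacteristic A F \<eta> \<alpha> \<longrightarrow>
     general_source G \<L> \<longrightarrow> L = \<L> {0} \<longrightarrow>
     (\<forall>\<epsilon>>0. smooth_on (strip T) (u \<epsilon>) \<and> solves A F G T \<epsilon> (u \<epsilon>) \<and> decays_fast T (u \<epsilon>)) \<longrightarrow>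
     (\<forall>\<epsilon>>0. \<forall>t\<in>{0..T}. energy T \<epsilon> (u \<epsilon>) t \<le> C * energy T \<epsilon> (u \<epsilon>) 0)"
\<comment> \<open>\<open>C\<close> is chosen before the hypotheses that force
  \<open>\<alpha>\<close>, \<open>\<beta>\<close>, \<open>L\<close> to be positive. If one of them
  is not, these hypotheses are contradictory and any positive \<open>C\<close>, such as 1,
  serves.\<close>
proof (cases "0 < \<alpha> \<and> 0 < \<beta> \<and> 0 < L")
  case True
  then have pos: "0 < \<alpha>" "0 < \<beta>" "0 < L" by auto
  obtain \<mu> where \<mu>: "0 < \<mu>" "\<And>v. \<mu> * (norm v)\<^sup>2 \<le> v \<bullet> (A *v v)"
    using pos_def_lower_bound[of A] assms(1) unfolding sym_pos_def_def by metis
  define \<Lambda> where "\<Lambda> = onorm ((*v) A)"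
  have \<Lambda>: "0 \<le> \<Lambda>"
    unfolding \<Lambda>_def by (rule onorm_pos_le) (rule matrix_vector_mul_bounded_linear)
  \<comment> \<open>The minimum of the three coefficients in the lower bound for the density: those
    of \<open>|u|\<^sup>2\<close>, of \<open>\<epsilon>\<^sup>2 |u_t|\<^sup>2\<close>, and of
    \<open>\<epsilon>\<^sup>2 |u_x|\<^sup>2\<close> after
    \<open>\<mu> |w|\<^sup>2 \<le> w \<bullet> A w\<close>.\<close>
  define c where "c = min (\<beta> / 8) (min (\<alpha> / 8) (\<alpha> / 2 * \<mu>))"
  have c: "0 < c" "c \<le> \<beta> / 8" "c \<le> \<alpha> / 8" "c \<le> \<alpha> / 2 * \<mu>"
    using pos \<mu>(1) by (simp_all add: c_def)
  show ?thesis
  proof (intro exI[of _ "exp (\<alpha> * L / c * T) * (\<alpha> * (1 + \<Lambda>)) / c"] conjI allI impI ballI)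
    show "0 < exp (\<alpha> * L / c * T) * (\<alpha> * (1 + \<Lambda>)) / c"
      using pos \<Lambda> c(1) by simp
    fix F G \<eta> q \<L> and \<epsilon> t :: real and u :: "real \<Rightarrow> real \<times> real \<Rightarrow> real^'n"
    assume F: "smooth_on UNIV F" "entropy_condition F \<eta> q \<alpha> \<beta>" "subcharacteristic A F \<eta> \<alpha>"
      and G: "G 0 = 0" "general_source G \<L>" "L = \<L> {0}"
      and u: "\<forall>\<epsilon>>0. smooth_on (strip T) (u \<epsilon>) \<and> solves A F G T \<epsilon> (u \<epsilon>) \<and> decays_fast T (u \<epsilon>)"
      and \<epsilon>: "0 < \<epsilon>" and t: "t \<in> {0..T}"
    have "norm (G v) \<le> L * norm v" for v
      using G unfolding general_source_def
      by (metis compact_sing diff_zero insertI1)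
    then interpret relaxation_system A F G \<eta> q \<alpha> \<beta> L
      using assms(1) F by unfold_locales
    show "energy T \<epsilon> (u \<epsilon>) t \<le> exp (\<alpha> * L / c * T) * (\<alpha> * (1 + \<Lambda>)) / c * energy T \<epsilon> (u \<epsilon>) 0"
      using u \<epsilon> t by (intro energy_estimate[where \<mu>=\<mu>] pos assms(2) \<mu>(2) \<Lambda> c)
        (auto simp: \<Lambda>_def matrix_quadratic_form_upper_bound)
  qed
next
  case False
  have "\<not> (entropy_condition F \<eta> q \<alpha> \<beta> \<and> general_source G \<L> \<and> L = \<L> {0})"
    for F G :: "real^'n \<Rightarrow> real^'n" and \<eta> q \<L>
  proof
    assume *: "entropy_condition F \<eta> q \<alpha> \<beta> \<and> general_source G \<L> \<and> L = \<L> {0}"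
    then have "0 < \<alpha> \<and> 0 < \<beta>" by (simp add: entropy_condition_def)
    moreover have "0 < L"
      using * compact_sing[of "0 :: real^'n"] unfolding general_source_def by blast
    ultimately show False using False by blast
  qed
  then show ?thesis
    by (intro exI[of _ 1] conjI) auto
qed

end
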